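(* Let $F$ be any locally compact Hausdorff space. Let $G$ be the group $\mathrm{Homeo}(F)$ of self-homeomorphisms of $F$ endowed with Arens' $g$-topology. Let $B$ be any locally connected topological space and let $\kappa$ be a cardinal. Then any $F$-fiber bundle $p:E\to B$ that is covered by $\kappa$-many local trivializations $\{U_i\times F\}_{i\in I}$ is isomorphic to the pullback $f^*(E^\kappa G\times_G F)$ for some continuous map $f:B\to B^\kappa G$.
   Context: Arens' $g$-topology on $\mathrm{Homeo}(F)$, for $F$ locally compact Hausdorff, is the topology with subbase the sets $\{h\mid h(K)\subseteq W\}$ where $K\subseteq F$ is closed, $W\subseteq F$ is open, and at least one of $K$, $F-W$ is compact. (By a theorem of Arens it is the coarsest topology for which $\mathrm{Homeo}(F)$ is a topological group and the evaluation $\mathrm{Homeo}(F)\times F\to F$ is continuous.) An $F$-fiber bundle $p:E\to B$ is a locally trivial bundle with fiber $F$ and no given structure group; "covered by $\kappa$-many local trivializations" means there is an open cover $\{U_i\}_{i\in I}$ of $B$, $\mathrm{card}(I)=\kappa$, with $p^{-1}(U_i)\approx U_i\times F$ over $U_i$. Isomorphism means homeomorphism over $B$. For a topological space $(A,\mathcal{T})$, the indiscrete cone $c(A,\mathcal{T})$ is the set $A\sqcup\{0\}$ with topology $\mathcal{T}\cup\{A\sqcup\{0\}\}$. For a topological group $G$, a cardinal $\kappa$ and a set $I$ with $\mathrm{card}(I)=\kappa$, $E^\kappa G:=(c(G))^I-\{0\}^I$ with the subspace topology of the product topology, with right $G$-action that is diagonal and given by right multiplication on $G$ and fixing $0$;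 $B^\kappa G:=E^\kappa G/G$ with the quotient topology. $G=\mathrm{Homeo}(F)$ acts on $F$ on the left by evaluation; $E^\kappa G\times_G F:=(E^\kappa G\times F)/((eg,y)\sim(e,gy))$, which projects to $B^\kappa G$, and the pullback is taken along this projection. *)

theory Defs
  imports "HOL-Analysis.Analysis" "HOL-Algebra.Bij"
begin

section \<open>The homeomorphism group with Arens' g-topology\<close>

text \<open>Self-homeomorphisms are represented by functions that are \<^term>\<open>undefined\<close> outside the
  underlying set, as in \<^const>\<open>Bij\<close>, so that equal homeomorphisms are equal as functions.\<close>

definition Homeo :: "'f topology \<Rightarrow> ('f \<Rightarrow> 'f) set" where
  "Homeo F = {h \<in> extensional (topspace F). homeomorphic_map F F h}"

definition HomeoGroup :: "'f topology \<Rightarrow> ('f \<Rightarrow> 'f) monoid" where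
  "HomeoGroup F = BijGroup (topspace F) \<lparr>carrier := Homeo F\<rparr>"

definition arens_g_topology :: "'f topology \<Rightarrow> ('f \<Rightarrow> 'f) topology" where
  "arens_g_topology F = topology_generated_by
     {{h \<in> Homeo F. h ` K \<subseteq> W} | K W.
        closedin F K \<and> openin F W \<and> (compactin F K \<or> compactin F (topspace F - W))}"

lemma topspace_arens_g_topology [simp]: "topspace (arens_g_topology F) = Homeo F"
proof -
  have "Homeo F = {h \<in> Homeo F. h ` {} \<subseteq> {}} \<and> closedin F {} \<and> openin F {} \<and> compactin F {}"
    by auto
  then show ?thesis
    unfolding arens_g_topology_def topology_generated_by_topspace by blast
qed

lemma subgroup_Homeo: "subgroup (Homeo F) (BijGroup (topspace F))"
proof (rule subgroup.intro)
  have bij: "h \<in> Bij (topspace F)" if "h \<in> Homeo F" for h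
    using that homeomorphic_imp_injective_map[of F F h] homeomorphic_imp_surjective_map[of F F h]
    by (auto simp: Homeo_def Bij_def bij_betw_def)
  then show "Homeo F \<subseteq> carrier (BijGroup (topspace F))"
    by (auto simp: BijGroup_def)
  show "x \<otimes>\<^bsub>BijGroup (topspace F)\<^esub> y \<in> Homeo F" if "x \<in> Homeo F" "y \<in> Homeo F" for x y
  proof -
    have "homeomorphic_map F F (x \<circ> y)"
      using that homeomorphic_map_compose by (fastforce simp: Homeo_def)
    then have "homeomorphic_map F F (compose (topspace F) x y)"
      by (rule homeomorphic_map_eq) (simp add: compose_def)
    then show ?thesis
      using that bij by (simp add: BijGroup_def Homeo_def)
  qed
  have "homeomorphic_map F F (\<lambda>x\<in>topspace F. x)"
    by (rule homeomorphic_map_eq[where f = id]) auto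
  then show "\<one>\<^bsub>BijGroup (topspace F)\<^esub> \<in> Homeo F"
    by (auto simp: BijGroup_def Homeo_def)
  show "inv\<^bsub>BijGroup (topspace F)\<^esub> x \<in> Homeo F" if x: "x \<in> Homeo F" for x
  proof -
    have "homeomorphic_map F F x"
      using x by (simp add: Homeo_def)
    then obtain g where g: "homeomorphic_maps F F x g"
      by (auto simp only: homeomorphic_map_maps)
    then have "homeomorphic_map F F g"
      by (simp add: homeomorphic_maps_map)
    then have "homeomorphic_map F F (\<lambda>y\<in>topspace F. inv_into (topspace F) x y)"
    proof (rule homeomorphic_map_eq)
      fix y
      assume y: "y \<in> topspace F"
      then have "g y \<in> topspace F" "x (g y) = y"
        using g by (auto simp: homeomorphic_maps_def continuous_map_def)
      moreover have "inj_on x (topspace F)"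
        using bij[OF x] by (simp add: Bij_def bij_betw_def)
      ultimately show "g y = (\<lambda>y\<in>topspace F. inv_into (topspace F) x y) y"
        using y inv_into_f_f[of x "topspace F" "g y"] by simp
    qed
    then show ?thesis
      by (simp add: inv_BijGroup[OF bij[OF x]] Homeo_def)
  qed
qed

lemma group_HomeoGroup: "group (HomeoGroup F)"
  unfolding HomeoGroup_def
  by (rule group.subgroup_imp_group[OF group_BijGroup subgroup_Homeo])

lemma HomeoGroup_evaluation:
  assumes "y \<in> topspace F"
  shows "h \<in> carrier (HomeoGroup F) \<Longrightarrow> h y \<in> topspace F"
    and "\<one>\<^bsub>HomeoGroup F\<^esub> y = y"
    and "\<lbrakk>g \<in> carrier (HomeoGroup F); h \<in> carrier (HomeoGroup F)\<rbrakk>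
         \<Longrightarrow> (g \<otimes>\<^bsub>HomeoGroup F\<^esub> h) y = g (h y)"
proof -
  show "h y \<in> topspace F" if "h \<in> carrier (HomeoGroup F)" for h
    using that assms homeomorphic_imp_surjective_map[of F F h]
    by (auto simp: HomeoGroup_def Homeo_def)
  show "\<one>\<^bsub>HomeoGroup F\<^esub> y = y"
    using assms by (simp add: HomeoGroup_def BijGroup_def)
  assume "g \<in> carrier (HomeoGroup F)" "h \<in> carrier (HomeoGroup F)"
  then have "g \<in> Bij (topspace F)" "h \<in> Bij (topspace F)"
    using subgroup.subset[OF subgroup_Homeo[of F]] by (auto simp: HomeoGroup_def BijGroup_def)
  then show "(g \<otimes>\<^bsub>HomeoGroup F\<^esub> h) y = g (h y)"
    using assms by (simp add: HomeoGroup_def BijGroup_def compose_def)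
qed

section \<open>Quotient spaces and pullbacks\<close>

text \<open>\<^term>\<open>R\<close> is meant to be an equivalence relation on \<^term>\<open>topspace X\<close>.\<close>

definition quotient_space :: "'a topology \<Rightarrow> ('a \<times> 'a) set \<Rightarrow> 'a set topology" where
  "quotient_space X R = topology (\<lambda>\<U>. \<U> \<subseteq> topspace X // R \<and> openin X {x \<in> topspace X. R `` {x} \<in> \<U>})"

lemma openin_quotient_space:
  "openin (quotient_space X R) \<U> \<longleftrightarrow>
     \<U> \<subseteq> topspace X // R \<and> openin X {x \<in> topspace X. R `` {x} \<in> \<U>}"
proof -
  have "istopology (\<lambda>\<U>. \<U> \<subseteq> topspace X // R \<and> openin X {x \<in> topspace X. R `` {x} \<in> \<U>})"
    unfolding istopology_def
  proof (intro conjI allI impI)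
    fix S T
    assume "S \<subseteq> topspace X // R \<and> openin X {x \<in> topspace X. R `` {x} \<in> S}"
      and "T \<subseteq> topspace X // R \<and> openin X {x \<in> topspace X. R `` {x} \<in> T}"
    moreover have "{x \<in> topspace X. R `` {x} \<in> S \<inter> T}
        = {x \<in> topspace X. R `` {x} \<in> S} \<inter> {x \<in> topspace X. R `` {x} \<in> T}"
      by auto
    ultimately show "S \<inter> T \<subseteq> topspace X // R" "openin X {x \<in> topspace X. R `` {x} \<in> S \<inter> T}"
      by (auto intro: openin_Int)
  next
    fix \<K>
    assume K: "\<forall>S\<in>\<K>. S \<subseteq> topspace X // R \<and> openin X {x \<in> topspace X. R `` {x} \<in> S}"
    then show "\<Union>\<K> \<subseteq> topspace X // R"
      by blast
    have "{x \<in> topspace X. R `` {x} \<in> \<Union>\<K>} = (\<Union>S\<in>\<K>. {x \<in> topspace X. R `` {x} \<in> S})"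
      by auto
    with K show "openin X {x \<in> topspace X. R `` {x} \<in> \<Union>\<K>}"
      by auto
  qed
  then show ?thesis
    by (simp add: quotient_space_def topology_inverse')
qed

lemma topspace_quotient_space [simp]: "topspace (quotient_space X R) = topspace X // R"
proof (rule antisym)
  show "topspace (quotient_space X R) \<subseteq> topspace X // R"
    using openin_topspace openin_quotient_space by blast
  have "{x \<in> topspace X. R `` {x} \<in> topspace X // R} = topspace X"
    by (auto intro: quotientI)
  then have "openin (quotient_space X R) (topspace X // R)"
    by (simp add: openin_quotient_space)
  then show "topspace X // R \<subseteq> topspace (quotient_space X R)"
    by (rule openin_subset)
qed

lemma quotient_map_quotient_space:
  "quotient_map X (quotient_space X R) (\<lambda>x. R `` {x})"
  by (auto simp: quotient_map_def openin_quotient_space quotient_def)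

text \<open>The total space of the pullback of \<^term>\<open>q :: 'e \<Rightarrow> 'c\<close> along \<^term>\<open>f :: 'b \<Rightarrow> 'c\<close>; its
  projection to the base is \<^const>\<open>fst\<close>.\<close>

definition pullback_space :: "'b topology \<Rightarrow> ('b \<Rightarrow> 'c) \<Rightarrow> 'e topology \<Rightarrow> ('e \<Rightarrow> 'c) \<Rightarrow> ('b \<times> 'e) topology" where
  "pullback_space B f Z q =
     subtopology (prod_topology B Z) {(b, z). b \<in> topspace B \<and> z \<in> topspace Z \<and> f b = q z}"

section \<open>Fiber bundles without structure group\<close>

definition homeomorphic_map_over ::
    "'e topology \<Rightarrow> ('e \<Rightarrow> 'b) \<Rightarrow> 'd topology \<Rightarrow> ('d \<Rightarrow> 'b) \<Rightarrow> ('e \<Rightarrow> 'd) \<Rightarrow> bool" where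
  "homeomorphic_map_over X p Y q \<phi> \<longleftrightarrow>
     homeomorphic_map X Y \<phi> \<and> (\<forall>x \<in> topspace X. q (\<phi> x) = p x)"

definition trivial_over ::
    "'e topology \<Rightarrow> ('e \<Rightarrow> 'b) \<Rightarrow> 'b topology \<Rightarrow> 'f topology \<Rightarrow> 'b set \<Rightarrow> bool" where
  "trivial_over E p B F U \<longleftrightarrow>
     (\<exists>\<phi>. homeomorphic_map_over (subtopology E {x \<in> topspace E. p x \<in> U}) p
            (prod_topology (subtopology B U) F) fst \<phi>)"

definition fiber_bundle :: "'e topology \<Rightarrow> ('e \<Rightarrow> 'b) \<Rightarrow> 'b topology \<Rightarrow> 'f topology \<Rightarrow> bool" where
  "fiber_bundle E p B F \<longleftrightarrow>
     continuous_map E B p \<and>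
     (\<forall>b \<in> topspace B. \<exists>U. openin B U \<and> b \<in> U \<and> trivial_over E p B F U)"

definition trivializing_cover ::
    "'e topology \<Rightarrow> ('e \<Rightarrow> 'b) \<Rightarrow> 'b topology \<Rightarrow> 'f topology \<Rightarrow> 'i set \<Rightarrow> ('i \<Rightarrow> 'b set) \<Rightarrow> bool" where
  "trivializing_cover E p B F I U \<longleftrightarrow>
     (\<forall>i \<in> I. openin B (U i) \<and> trivial_over E p B F (U i)) \<and> (\<Union>i\<in>I. U i) = topspace B"

section \<open>The universal bundle built from indiscrete cones\<close>

text \<open>The cone point is \<^const>\<open>None\<close>.\<close>

definition indiscrete_cone :: "'a topology \<Rightarrow> 'a option topology" where
  "indiscrete_cone T = topology (\<lambda>V. (\<exists>U. openin T U \<and> V = Some ` U) \<or> V = insert None (Some ` topspace T))"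

lemma openin_indiscrete_cone:
  "openin (indiscrete_cone T) V \<longleftrightarrow> (\<exists>U. openin T U \<and> V = Some ` U) \<or> V = insert None (Some ` topspace T)"
proof -
  let ?P = "\<lambda>V. (\<exists>U. openin T U \<and> V = Some ` U) \<or> V = insert None (Some ` topspace T)"
  have "istopology ?P"
    unfolding istopology_def
  proof (intro conjI allI impI)
    fix S V
    assume S: "?P S" and V: "?P V"
    have sub: "Some ` U \<inter> insert None (Some ` topspace T) = Some ` U"
        "insert None (Some ` topspace T) \<inter> Some ` U = Some ` U" if "openin T U" for U
      using openin_subset[OF that] by auto
    have "\<exists>U. openin T U \<and> Some ` U1 \<inter> Some ` U2 = Some ` U" if "openin T U1" "openin T U2" for U1 U2
      using that by (intro exI[of _ "U1 \<inter> U2"]) auto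
    with S V sub show "?P (S \<inter> V)"
      by (metis inf.idem)
  next
    fix \<K>
    assume K: "\<forall>S\<in>\<K>. ?P S"
    let ?W = "insert None (Some ` topspace T)"
    have sub: "S \<subseteq> ?W" if "S \<in> \<K>" for S
    proof -
      from K that consider U where "openin T U" "S = Some ` U" | "S = ?W"
        by blast
      then show ?thesis
        by cases (auto dest: openin_subset)
    qed
    show "?P (\<Union>\<K>)"
    proof (cases "?W \<in> \<K>")
      case True
      then have "\<Union>\<K> = ?W"
        using sub by blast
      then show ?thesis
        by blast
    next
      case False
      with K have *: "\<exists>U. openin T U \<and> S = Some ` U" if "S \<in> \<K>" for S
        using that by blast
      then obtain u where u: "\<And>S. S \<in> \<K> \<Longrightarrow> openin T (u S) \<and> S = Some ` u S"
        by metis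
      then have "\<Union>\<K> = Some ` (\<Union>S\<in>\<K>. u S)"
        by blast
      moreover have "openin T (\<Union>S\<in>\<K>. u S)"
        using u by blast
      ultimately show ?thesis
        by (intro disjI1 exI[of _ "\<Union>S\<in>\<K>. u S"] conjI)
    qed
  qed
  then show ?thesis
    by (simp add: indiscrete_cone_def topology_inverse')
qed

lemma topspace_indiscrete_cone [simp]: "topspace (indiscrete_cone T) = insert None (Some ` topspace T)"
proof (rule antisym)
  show "topspace (indiscrete_cone T) \<subseteq> insert None (Some ` topspace T)"
  proof -
    have "(\<exists>U. openin T U \<and> topspace (indiscrete_cone T) = Some ` U)
        \<or> topspace (indiscrete_cone T) = insert None (Some ` topspace T)"
      using openin_topspace[of "indiscrete_cone T"] by (simp only: openin_indiscrete_cone)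
    then show ?thesis
    proof (elim disjE exE conjE)
      fix U
      assume "openin T U" "topspace (indiscrete_cone T) = Some ` U"
      then show ?thesis
        using openin_subset[of T U] by auto
    qed simp
  qed
  show "insert None (Some ` topspace T) \<subseteq> topspace (indiscrete_cone T)"
    by (rule openin_subset) (simp add: openin_indiscrete_cone)
qed

text \<open>Below, \<^term>\<open>T\<close> is the topology of a topological group with underlying group \<^term>\<open>G\<close>, so
  \<^term>\<open>topspace T = carrier G\<close>, and \<^term>\<open>I\<close> is an index set of cardinality \<open>\<kappa>\<close>. The points of the
  power of the cone are the functions that are \<^term>\<open>undefined\<close> outside \<^term>\<open>I\<close>.\<close>

definition univ_total :: "'g topology \<Rightarrow> 'i set \<Rightarrow> ('i \<Rightarrow> 'g option) topology" where
  "univ_total T I =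
     subtopology (product_topology (\<lambda>i. indiscrete_cone T) I)
       (topspace (product_topology (\<lambda>i. indiscrete_cone T) I) - {\<lambda>i\<in>I. None})"

definition right_act ::
    "('g, 'm) monoid_scheme \<Rightarrow> 'i set \<Rightarrow> ('i \<Rightarrow> 'g option) \<Rightarrow> 'g \<Rightarrow> ('i \<Rightarrow> 'g option)" where
  "right_act G I e g = (\<lambda>i\<in>I. map_option (\<lambda>a. a \<otimes>\<^bsub>G\<^esub> g) (e i))"

definition orbit_rel ::
    "('g, 'm) monoid_scheme \<Rightarrow> 'g topology \<Rightarrow> 'i set \<Rightarrow> (('i \<Rightarrow> 'g option) \<times> ('i \<Rightarrow> 'g option)) set" where
  "orbit_rel G T I = {(e, right_act G I e g) | e g. e \<in> topspace (univ_total T I) \<and> g \<in> carrier G}"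

definition univ_base ::
    "('g, 'm) monoid_scheme \<Rightarrow> 'g topology \<Rightarrow> 'i set \<Rightarrow> ('i \<Rightarrow> 'g option) set topology" where
  "univ_base G T I = quotient_space (univ_total T I) (orbit_rel G T I)"

definition balanced_rel ::
    "('g, 'm) monoid_scheme \<Rightarrow> 'g topology \<Rightarrow> 'i set \<Rightarrow> ('g \<Rightarrow> 'f \<Rightarrow> 'f) \<Rightarrow> 'f topology \<Rightarrow>
      ((('i \<Rightarrow> 'g option) \<times> 'f) \<times> (('i \<Rightarrow> 'g option) \<times> 'f)) set" where
  "balanced_rel G T I act F =
     {((right_act G I e g, y), (e, act g y)) | e g y.
        e \<in> topspace (univ_total T I) \<and> g \<in> carrier G \<and> y \<in> topspace F}"

definition assoc_total ::
    "('g, 'm) monoid_scheme \<Rightarrow> 'g topology \<Rightarrow> 'i set \<Rightarrow> ('g \<Rightarrow> 'f \<Rightarrow> 'f) \<Rightarrow> 'f topology \<Rightarrow>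
      (('i \<Rightarrow> 'g option) \<times> 'f) set topology" where
  "assoc_total G T I act F =
     quotient_space (prod_topology (univ_total T I) F) (balanced_rel G T I act F)"

text \<open>The class of \<^term>\<open>(e, y)\<close> consists of the pairs of \<open>e g\<close> and \<open>g\<inverse> y\<close>, so the set of
  its first components is the orbit of \<^term>\<open>e\<close>; see \<open>assoc_proj_class\<close> below.\<close>

definition assoc_proj :: "(('i \<Rightarrow> 'g option) \<times> 'f) set \<Rightarrow> ('i \<Rightarrow> 'g option) set" where
  "assoc_proj C = fst ` C"

lemma topspace_univ_total:
  "topspace (univ_total T I) = (I \<rightarrow>\<^sub>E insert None (Some ` topspace T)) - {\<lambda>i\<in>I. None}"
  by (auto simp: univ_total_def)

context group
begin

context
  fixes T :: "'a topology" and I :: "'i set"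
  assumes T: "topspace T = carrier G"
begin

lemma right_act_closed:
  assumes e: "e \<in> topspace (univ_total T I)" and g: "g \<in> carrier G"
  shows "right_act G I e g \<in> topspace (univ_total T I)"
proof -
  have mem: "e i = None \<or> (\<exists>a\<in>carrier G. e i = Some a)" if "i \<in> I" for i
    using e that T by (fastforce simp: topspace_univ_total dest: PiE_mem)
  have "e \<noteq> (\<lambda>i\<in>I. None)" "e \<in> extensional I"
    using e by (auto simp: topspace_univ_total PiE_def)
  then obtain i where "i \<in> I" "e i \<noteq> None"
    by (metis (no_types, lifting) extensionalityI restrict_apply' restrict_extensional)
  then have "right_act G I e g i \<noteq> (\<lambda>i\<in>I. None) i"
    by (auto simp: right_act_def)
  then have "right_act G I e g \<noteq> (\<lambda>i\<in>I. None)"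
    by metis
  moreover have "right_act G I e g \<in> (I \<rightarrow>\<^sub>E insert None (Some ` carrier G))"
    using mem g by (fastforce simp: right_act_def)
  ultimately show ?thesis
    by (simp add: topspace_univ_total T)
qed

lemma right_act_mult:
  assumes e: "e \<in> topspace (univ_total T I)" and "g \<in> carrier G" "h \<in> carrier G"
  shows "right_act G I (right_act G I e g) h = right_act G I e (g \<otimes> h)"
proof -
  have mem: "e i = None \<or> (\<exists>a\<in>carrier G. e i = Some a)" if "i \<in> I" for i
    using e that T by (fastforce simp: topspace_univ_total dest: PiE_mem)
  then show ?thesis
    using assms by (fastforce simp: right_act_def m_assoc intro!: restrict_ext)
qed

lemma right_act_one:
  assumes e: "e \<in> topspace (univ_total T I)"
  shows "right_act G I e \<one> = e"
proof
  fix i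
  have "e i = None \<or> (\<exists>a\<in>carrier G. e i = Some a)" if "i \<in> I"
    using e that T by (fastforce simp: topspace_univ_total dest: PiE_mem)
  moreover have "e i = undefined" if "i \<notin> I"
    using e that by (auto simp: topspace_univ_total dest: PiE_arb)
  ultimately show "right_act G I e \<one> i = e i"
    by (auto simp: right_act_def)
qed

lemma equiv_orbit_rel: "equiv (topspace (univ_total T I)) (orbit_rel G T I)"
proof (rule equivI)
  show "orbit_rel G T I \<subseteq> topspace (univ_total T I) \<times> topspace (univ_total T I)"
    by (auto simp: orbit_rel_def right_act_closed)
  show "refl_on (topspace (univ_total T I)) (orbit_rel G T I)"
  proof (rule refl_onI)
    fix e
    assume "e \<in> topspace (univ_total T I)"
    then show "(e, e) \<in> orbit_rel G T I"
      unfolding orbit_rel_def using right_act_one[of e] one_closed by (metis (mono_tags, lifting) mem_Collect_eq)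
  qed
  show "sym (orbit_rel G T I)"
  proof (rule symI)
    fix a b
    assume "(a, b) \<in> orbit_rel G T I"
    then obtain g where g: "a \<in> topspace (univ_total T I)" "g \<in> carrier G" "b = right_act G I a g"
      by (auto simp: orbit_rel_def)
    then have "a = right_act G I b (inv g)"
      by (simp add: right_act_mult right_act_one)
    moreover have "b \<in> topspace (univ_total T I)"
      using g by (simp add: right_act_closed)
    ultimately show "(b, a) \<in> orbit_rel G T I"
      unfolding orbit_rel_def using g(2) inv_closed by blast
  qed
  show "trans (orbit_rel G T I)"
  proof (rule transI)
    fix a b c
    assume "(a, b) \<in> orbit_rel G T I" "(b, c) \<in> orbit_rel G T I"
    then obtain g h where g: "a \<in> topspace (univ_total T I)" "g \<in> carrier G" "b = right_act G I a g"
        and h: "h \<in> carrier G" "c = right_act G I b h"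
      by (auto simp: orbit_rel_def)
    then have "c = right_act G I a (g \<otimes> h)"
      by (simp add: right_act_mult)
    with g h show "(a, c) \<in> orbit_rel G T I"
      unfolding orbit_rel_def by blast
  qed
qed

context
  fixes act :: "'a \<Rightarrow> 'f \<Rightarrow> 'f" and F :: "'f topology"
  assumes act_closed: "\<And>g y. \<lbrakk>g \<in> carrier G; y \<in> topspace F\<rbrakk> \<Longrightarrow> act g y \<in> topspace F"
    and act_one: "\<And>y. y \<in> topspace F \<Longrightarrow> act \<one> y = y"
    and act_mult: "\<And>g h y. \<lbrakk>g \<in> carrier G; h \<in> carrier G; y \<in> topspace F\<rbrakk>
                      \<Longrightarrow> act (g \<otimes> h) y = act g (act h y)"
begin

lemma balanced_rel_iff:
  "((e, y), (e', y')) \<in> balanced_rel G T I act F \<longleftrightarrow>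
     e \<in> topspace (univ_total T I) \<and> y \<in> topspace F \<and>
     (\<exists>g \<in> carrier G. e' = right_act G I e g \<and> y' = act (inv g) y)"
proof
  assume "((e, y), (e', y')) \<in> balanced_rel G T I act F"
  then obtain g where g: "g \<in> carrier G" "e = right_act G I e' g" "y' = act g y"
      "e' \<in> topspace (univ_total T I)" "y \<in> topspace F"
    by (auto simp: balanced_rel_def)
  then have "e' = right_act G I e (inv g)" "y' = act (inv (inv g)) y"
    by (simp_all add: right_act_mult right_act_one)
  moreover have "e \<in> topspace (univ_total T I)" "inv g \<in> carrier G"
    using g by (simp_all add: right_act_closed)
  ultimately show "e \<in> topspace (univ_total T I) \<and> y \<in> topspace F \<and>
     (\<exists>g \<in> carrier G. e' = right_act G I e g \<and> y' = act (inv g) y)"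
    using g(5) by blast
next
  assume "e \<in> topspace (univ_total T I) \<and> y \<in> topspace F \<and>
     (\<exists>g \<in> carrier G. e' = right_act G I e g \<and> y' = act (inv g) y)"
  then obtain g where g: "e \<in> topspace (univ_total T I)" "y \<in> topspace F" "g \<in> carrier G"
      "e' = right_act G I e g" "y' = act (inv g) y"
    by blast
  then have "e = right_act G I e' (inv g)" "e' \<in> topspace (univ_total T I)"
    by (simp_all add: right_act_mult right_act_one right_act_closed)
  moreover have "inv g \<in> carrier G"
    using g by simp
  ultimately show "((e, y), (e', y')) \<in> balanced_rel G T I act F"
    unfolding balanced_rel_def mem_Collect_eq using g(2,5) by blast
qed

lemma equiv_balanced_rel:
  "equiv (topspace (prod_topology (univ_total T I) F)) (balanced_rel G T I act F)"
proof (rule equivI)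
  let ?R = "balanced_rel G T I act F"
  let ?E = "topspace (univ_total T I)"
  show "?R \<subseteq> topspace (prod_topology (univ_total T I) F) \<times> topspace (prod_topology (univ_total T I) F)"
    by (auto simp: balanced_rel_def right_act_closed act_closed)
  have "((e, y), (e, y)) \<in> ?R" if "e \<in> ?E" "y \<in> topspace F" for e y
    unfolding balanced_rel_iff using that
    by (auto intro!: bexI[of _ \<one>] simp: right_act_one act_one)
  then show "refl_on (topspace (prod_topology (univ_total T I) F)) ?R"
    by (auto simp: refl_on_def)
  have "((e', y'), (e, y)) \<in> ?R" if R: "((e, y), (e', y')) \<in> ?R" for e y e' y'
  proof -
    obtain g where g: "e \<in> ?E" "y \<in> topspace F" "g \<in> carrier G"
        "e' = right_act G I e g" "y' = act (inv g) y"
      using R by (auto simp: balanced_rel_iff)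
    then have "act g y' = y"
      using act_mult[of g "inv g" y] by (simp add: act_one)
    moreover have "e' \<in> ?E" "y' \<in> topspace F"
      using g by (simp_all add: right_act_closed act_closed)
    ultimately show ?thesis
      unfolding balanced_rel_iff using g
      by (intro conjI bexI[of _ "inv g"]) (simp_all add: right_act_mult right_act_one)
  qed
  then show "sym ?R"
    by (auto intro!: symI)
  have "((e, y), (e'', y'')) \<in> ?R"
    if R: "((e, y), (e', y')) \<in> ?R" "((e', y'), (e'', y'')) \<in> ?R" for e y e' y' e'' y''
  proof -
    obtain g where g: "e \<in> ?E" "y \<in> topspace F" "g \<in> carrier G"
        "e' = right_act G I e g" "y' = act (inv g) y"
      using R(1) by (auto simp: balanced_rel_iff)
    obtain h where h: "h \<in> carrier G" "e'' = right_act G I e' h" "y'' = act (inv h) y'"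
      using R(2) by (auto simp: balanced_rel_iff)
    have "e'' = right_act G I e (g \<otimes> h)" "y'' = act (inv (g \<otimes> h)) y"
      using g h by (simp_all add: right_act_mult inv_mult_group act_mult)
    then show ?thesis
      unfolding balanced_rel_iff using g(1-3) h(1)
      by (intro conjI bexI[of _ "g \<otimes> h"]) simp_all
  qed
  then show "trans ?R"
    by (auto intro!: transI)
qed

lemma assoc_proj_class:
  assumes "e \<in> topspace (univ_total T I)" "y \<in> topspace F"
  shows "assoc_proj (balanced_rel G T I act F `` {(e, y)}) = orbit_rel G T I `` {e}"
proof -
  have "fst ` (balanced_rel G T I act F `` {(e, y)}) = {right_act G I e g | g. g \<in> carrier G}"
  proof (intro subset_antisym subsetI)
    fix e'
    assume "e' \<in> fst ` (balanced_rel G T I act F `` {(e, y)})"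
    then show "e' \<in> {right_act G I e g | g. g \<in> carrier G}"
      by (auto simp: balanced_rel_iff)
  next
    fix e'
    assume "e' \<in> {right_act G I e g | g. g \<in> carrier G}"
    then obtain g where "g \<in> carrier G" "e' = right_act G I e g"
      by blast
    then have "((e, y), (e', act (inv g) y)) \<in> balanced_rel G T I act F"
      using assms by (auto simp: balanced_rel_iff)
    then show "e' \<in> fst ` (balanced_rel G T I act F `` {(e, y)})"
      by (metis Image_singleton_iff fst_conv imageI)
  qed
  also have "\<dots> = orbit_rel G T I `` {e}"
    using assms(1) by (auto simp: orbit_rel_def)
  finally show ?thesis
    by (simp add: assoc_proj_def)
qed

end

end

end

end

theory Submission
  imports Defs
begin

text \<open>Charts of the bundle over \<open>U j\<close>, for \<open>j\<close> in \<open>J\<close>, differ over \<open>U i \<inter> U j\<close> by homeomorphisms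
  \<open>g\<^sub>j\<^sub>i b\<close> of \<open>F\<close> with \<open>g\<^sub>j\<^sub>i g\<^sub>i\<^sub>k = g\<^sub>j\<^sub>k\<close>. At a point \<open>b\<close> of \<open>U i\<close>, these form a frame, the
  point of the power of the cone whose entry at \<open>j\<close> is \<open>g\<^sub>j\<^sub>i b\<close> if \<open>b\<close> lies in \<open>U j\<close> and the cone
  point otherwise. By the cocycle identity, the frames at \<open>b\<close> for different \<open>i\<close> lie in one orbit;
  this orbit is the value at \<open>b\<close> of the classifying map. Two facts make the map continuous.
  The cone point has no neighborhood but the whole cone, so a map into the cone is continuous
  as soon as it is so on the open set where it avoids the cone point: \<open>g\<^sub>j\<^sub>i\<close> can
  simply be extended by the cone point (\<open>continuous_map_into_indiscrete_cone\<close>). And \<open>g\<^sub>j\<^sub>i\<close> is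
  continuous for the g-topology, because both it and its pointwise inverse \<open>g\<^sub>i\<^sub>j\<close> are jointly
  continuous in \<open>(b, y)\<close> (\<open>continuous_map_into_arens_g_topology\<close>).

  The isomorphism sends \<open>x\<close> over \<open>b\<close>, with fiber coordinate \<open>y\<close> in the \<open>i\<close>-th chart, to the class of
  the frame at \<open>b\<close> for \<open>i\<close> together with \<open>y\<close>; changing \<open>i\<close> moves both within the class. For its
  inverse, the associated bundle has fiber coordinates of its own: on the open set of
  classes \<open>[e, y]\<close> with \<open>e i\<close> in the group, the point \<open>e i y\<close> of \<open>F\<close> depends on the class only, and
  continuously so because evaluation is jointly continuous for the g-topology
  (\<open>continuous_map_assoc_coord\<close>). The \<open>i\<close>-th entry of the \<open>i\<close>-th frame is the identity, so this
  point is the \<open>i\<close>-th fiber coordinate of the wanted preimage.\<close>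

section \<open>The g-topology and jointly continuous families of homeomorphisms\<close>

lemma openin_tube:
  assumes W: "openin (prod_topology X Y) W" and K: "compactin Y K"
  shows "openin X {x \<in> topspace X. {x} \<times> K \<subseteq> W}"
proof (rule openin_subopen[THEN iffD2], rule ballI)
  fix x assume "x \<in> {x \<in> topspace X. {x} \<times> K \<subseteq> W}"
  then have "x \<in> topspace X" "{x} \<times> K \<subseteq> W"
    by simp_all
  then obtain U V where UV: "openin X U" "x \<in> U" "K \<subseteq> V" "U \<times> V \<subseteq> W"
    using tube_lemma_right[OF W K, of x] by metis
  have "U \<subseteq> {x \<in> topspace X. {x} \<times> K \<subseteq> W}"
    using openin_subset[OF UV(1)] UV(3,4) by auto
  with UV(1,2) show "\<exists>T. openin X T \<and> x \<in> T \<and> T \<subseteq> {x \<in> topspace X. {x} \<times> K \<subseteq> W}"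
    by blast
qed

text \<open>For compact \<open>K\<close>, the condition \<open>h x ` K \<subseteq> W\<close> is open in \<open>x\<close> by the tube lemma. For compact
  \<open>F - W\<close>, it says that \<open>k x\<close> maps \<open>F - W\<close> into the open set \<open>F - K\<close>, and the tube lemma applies to \<open>k\<close>.\<close>

lemma continuous_map_into_arens_g_topology:
  assumes h: "continuous_map (prod_topology X F) F (\<lambda>(x, y). h x y)"
    and k: "continuous_map (prod_topology X F) F (\<lambda>(x, y). k x y)"
    and kh: "\<And>x y. \<lbrakk>x \<in> topspace X; y \<in> topspace F\<rbrakk> \<Longrightarrow> k x (h x y) = y"
    and hk: "\<And>x y. \<lbrakk>x \<in> topspace X; y \<in> topspace F\<rbrakk> \<Longrightarrow> h x (k x y) = y"
  shows "continuous_map X (arens_g_topology F) (\<lambda>x. \<lambda>y\<in>topspace F. h x y)"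
proof -
  let ?h = "\<lambda>x. \<lambda>y\<in>topspace F. h x y"
  have slice: "continuous_map F F (g x)"
    if "continuous_map (prod_topology X F) F (\<lambda>(x, y). g x y)" "x \<in> topspace X" for g x
  proof -
    have "continuous_map F (prod_topology X F) (\<lambda>y. (x, y))"
      using that(2) by (simp add: continuous_map_paired)
    from continuous_map_compose[OF this that(1)] show ?thesis
      by (simp add: o_def)
  qed
  have closed: "h x y \<in> topspace F" "k x y \<in> topspace F"
    if "x \<in> topspace X" "y \<in> topspace F" for x y
    using slice[OF h] slice[OF k] that by (auto dest!: continuous_map_funspace)
  have Homeo: "?h x \<in> Homeo F" if x: "x \<in> topspace X" for x
  proof -
    have "homeomorphic_maps F F (h x) (k x)"
      using slice[OF h x] slice[OF k x] kh hk x by (simp add: homeomorphic_maps_def)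
    then have "homeomorphic_map F F (h x)"
      by (rule homeomorphic_maps_imp_map)
    then have "homeomorphic_map F F (?h x)"
      by (rule homeomorphic_map_eq) simp
    then show ?thesis
      by (simp add: Homeo_def)
  qed
  show ?thesis
    unfolding arens_g_topology_def
  proof (rule continuous_on_generated_topo)
    show "?h ` topspace X \<subseteq> \<Union> {{h \<in> Homeo F. h ` K \<subseteq> W} | K W.
        closedin F K \<and> openin F W \<and> (compactin F K \<or> compactin F (topspace F - W))}"
      using Homeo topspace_arens_g_topology[of F]
      unfolding arens_g_topology_def topology_generated_by_topspace by blast
  next
    fix N assume "N \<in> {{h \<in> Homeo F. h ` K \<subseteq> W} | K W.
        closedin F K \<and> openin F W \<and> (compactin F K \<or> compactin F (topspace F - W))}"
    then obtain K W where N: "N = {h \<in> Homeo F. h ` K \<subseteq> W}"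
      and K: "closedin F K" and W: "openin F W"
      and c: "compactin F K \<or> compactin F (topspace F - W)"
      by blast
    have KF: "K \<subseteq> topspace F" and WF: "W \<subseteq> topspace F"
      using K W by (simp_all add: closedin_subset openin_subset)
    have N_iff: "?h -` N \<inter> topspace X = {x \<in> topspace X. \<forall>y\<in>K. h x y \<in> W}"
      using Homeo KF by (auto simp: N image_subset_iff subset_iff)
    from c show "openin X (?h -` N \<inter> topspace X)"
    proof
      assume "compactin F K"
      then have "openin X {x \<in> topspace X.
          {x} \<times> K \<subseteq> {z \<in> topspace (prod_topology X F). (case z of (x, y) \<Rightarrow> h x y) \<in> W}}"
        using openin_continuous_map_preimage[OF h W] by (rule openin_tube[rotated])
      moreover have "?h -` N \<inter> topspace X = {x \<in> topspace X.
          {x} \<times> K \<subseteq> {z \<in> topspace (prod_topology X F). (case z of (x, y) \<Rightarrow> h x y) \<in> W}}"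
        using KF by (auto simp: N_iff)
      ultimately show ?thesis
        by simp
    next
      assume C: "compactin F (topspace F - W)"
      have "openin F (topspace F - K)"
        using K by (simp add: closedin_def)
      from openin_tube[OF openin_continuous_map_preimage[OF k this] C]
      have tube: "openin X {x \<in> topspace X. {x} \<times> (topspace F - W) \<subseteq>
          {z \<in> topspace (prod_topology X F). (case z of (x, y) \<Rightarrow> k x y) \<in> topspace F - K}}" .
      have "(\<forall>y\<in>K. h x y \<in> W) \<longleftrightarrow> (\<forall>y\<in>topspace F - W. k x y \<notin> K)"
        if x: "x \<in> topspace X" for x
      proof (intro iffI ballI notI)
        fix y assume "\<forall>y\<in>K. h x y \<in> W" "y \<in> topspace F - W" "k x y \<in> K"
        then show False
          using hk[OF x, of y] by force
      next
        fix y assume *: "\<forall>y\<in>topspace F - W. k x y \<notin> K" and y: "y \<in> K"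
        show "h x y \<in> W"
        proof (rule ccontr)
          assume "h x y \<notin> W"
          then have "k x (h x y) \<notin> K"
            using * closed(1)[OF x] y KF by blast
          then show False
            using kh[OF x] y KF by auto
        qed
      qed
      moreover have "{x} \<times> (topspace F - W) \<subseteq>
          {z \<in> topspace (prod_topology X F). (case z of (x, y) \<Rightarrow> k x y) \<in> topspace F - K}
          \<longleftrightarrow> (\<forall>y\<in>topspace F - W. k x y \<notin> K)" if "x \<in> topspace X" for x
        using closed(2)[OF that] that by fastforce
      ultimately have "?h -` N \<inter> topspace X = {x \<in> topspace X. {x} \<times> (topspace F - W) \<subseteq>
          {z \<in> topspace (prod_topology X F). (case z of (x, y) \<Rightarrow> k x y) \<in> topspace F - K}}"
        unfolding N_iff by (intro Collect_cong conj_cong refl) simp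
      with tube show ?thesis
        by simp
    qed
  qed
qed

text \<open>Joint continuity of evaluation: if \<open>g y \<in> W\<close>, then \<open>y\<close> has a compact closed neighborhood \<open>K\<close> with
  \<open>g ` K \<subseteq> W\<close>, and \<open>{h. h ` K \<subseteq> W}\<close> is a neighborhood of \<open>g\<close>.\<close>

lemma openin_evaluation_preimage:
  assumes F: "locally_compact_space F" "Hausdorff_space F" and W: "openin F W"
  shows "openin (prod_topology (arens_g_topology F) F) {(g, y). g \<in> Homeo F \<and> y \<in> topspace F \<and> g y \<in> W}"
  unfolding openin_prod_topology_alt
proof (intro allI impI)
  fix g y
  assume "(g, y) \<in> {(g, y). g \<in> Homeo F \<and> y \<in> topspace F \<and> g y \<in> W}"
  then have g: "g \<in> Homeo F" and y: "y \<in> topspace F" "g y \<in> W"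
    by auto
  have "continuous_map F F g"
    using g by (simp add: Homeo_def homeomorphic_imp_continuous_map)
  then have "openin F {y \<in> topspace F. g y \<in> W}"
    using W by (rule openin_continuous_map_preimage)
  moreover have "neighbourhood_base_of (\<lambda>C. compactin F C \<and> closedin F C) F"
    using F locally_compact_space_neighbourhood_base_closedin[of F] by blast
  ultimately obtain V K where V: "openin F V" "y \<in> V" "V \<subseteq> K"
      and K: "compactin F K" "closedin F K" "K \<subseteq> {y \<in> topspace F. g y \<in> W}"
    unfolding neighbourhood_base_of using y by (metis (mono_tags, lifting) mem_Collect_eq)
  let ?N = "{h \<in> Homeo F. h ` K \<subseteq> W}"
  have "openin (arens_g_topology F) ?N"
    unfolding arens_g_topology_def by (rule topology_generated_by_Basis) (use K W in blast)
  moreover have "g \<in> ?N" "?N \<times> V \<subseteq> {(g, y). g \<in> Homeo F \<and> y \<in> topspace F \<and> g y \<in> W}"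
    using g K V by auto
  ultimately show "\<exists>U V. openin (arens_g_topology F) U \<and> openin F V \<and> g \<in> U \<and> y \<in> V \<and>
      U \<times> V \<subseteq> {(g, y). g \<in> Homeo F \<and> y \<in> topspace F \<and> g y \<in> W}"
    using V by blast
qed

section \<open>Partially defined maps into the indiscrete cone\<close>

text \<open>An open set that contains the cone point is the whole cone, so its preimage is everything.\<close>

lemma continuous_map_into_indiscrete_cone:
  assumes D: "openin X D" and h: "continuous_map (subtopology X D) T h"
  shows "continuous_map X (indiscrete_cone T) (\<lambda>x. if x \<in> D then Some (h x) else None)"
  unfolding continuous_map_def
proof (intro conjI allI impI)
  show mem: "(\<lambda>x. if x \<in> D then Some (h x) else None) \<in> topspace X \<rightarrow> topspace (indiscrete_cone T)"
    using continuous_map_funspace[OF h] by (auto simp: Pi_iff)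
  fix V assume "openin (indiscrete_cone T) V"
  then consider W where "openin T W" "V = Some ` W" | "V = topspace (indiscrete_cone T)"
    by (auto simp: openin_indiscrete_cone)
  then show "openin X {x \<in> topspace X. (if x \<in> D then Some (h x) else None) \<in> V}"
  proof cases
    case 1
    then have "openin (subtopology X D) {x \<in> topspace (subtopology X D). h x \<in> W}"
      using openin_continuous_map_preimage[OF h] by blast
    then have "openin X {x \<in> topspace (subtopology X D). h x \<in> W}"
      using D openin_trans_full by blast
    moreover have "{x \<in> topspace (subtopology X D). h x \<in> W}
        = {x \<in> topspace X. (if x \<in> D then Some (h x) else None) \<in> V}"
      using 1 by auto
    ultimately show ?thesis
      by simp
  next
    case 2
    then have "{x \<in> topspace X. (if x \<in> D then Some (h x) else None) \<in> V} = topspace X"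
      using Pi_mem[OF mem] by blast
    then show ?thesis
      by simp
  qed
qed

lemma openin_prod_indiscrete_cone_Some:
  assumes S: "openin (prod_topology T Y) S"
  shows "openin (prod_topology (indiscrete_cone T) Y) {(Some g, y) | g y. (g, y) \<in> S}"
  unfolding openin_prod_topology_alt
proof (intro allI impI)
  fix c y assume "(c, y) \<in> {(Some g, y) | g y. (g, y) \<in> S}"
  then obtain g where g: "c = Some g" "(g, y) \<in> S"
    by blast
  then obtain U V where "openin T U" "openin Y V" "g \<in> U" "y \<in> V" "U \<times> V \<subseteq> S"
    using S by (metis openin_prod_topology_alt)
  then show "\<exists>U V. openin (indiscrete_cone T) U \<and> openin Y V \<and> c \<in> U \<and> y \<in> V \<and>
      U \<times> V \<subseteq> {(Some g, y) | g y. (g, y) \<in> S}"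
    using g by (intro exI[of _ "Some ` U"] exI[of _ V]) (auto simp: openin_indiscrete_cone)
qed

section \<open>The associated bundle with fiber F\<close>

lemma carrier_HomeoGroup [simp]: "carrier (HomeoGroup F) = Homeo F"
  by (simp add: HomeoGroup_def)

abbreviation homeo_univ :: "'f topology \<Rightarrow> 'j set \<Rightarrow> ('j \<Rightarrow> ('f \<Rightarrow> 'f) option) topology" where
  "homeo_univ F J \<equiv> univ_total (arens_g_topology F) J"

abbreviation homeo_orbit where
  "homeo_orbit F J e \<equiv> orbit_rel (HomeoGroup F) (arens_g_topology F) J `` {e}"

abbreviation homeo_balanced where
  "homeo_balanced F J \<equiv> balanced_rel (HomeoGroup F) (arens_g_topology F) J (\<lambda>h y. h y) F"

abbreviation homeo_assoc where
  "homeo_assoc F J \<equiv> assoc_total (HomeoGroup F) (arens_g_topology F) J (\<lambda>h y. h y) F"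

lemmas equiv_homeo_orbit =
  group.equiv_orbit_rel[OF group_HomeoGroup, of "arens_g_topology F" F for F, simplified]

lemma equiv_homeo_balanced:
  "equiv (topspace (prod_topology (homeo_univ F J) F)) (homeo_balanced F J)"
  by (rule group.equiv_balanced_rel[OF group_HomeoGroup]) (simp_all add: HomeoGroup_evaluation)

lemma assoc_proj_homeo:
  "\<lbrakk>e \<in> topspace (homeo_univ F J); y \<in> topspace F\<rbrakk>
   \<Longrightarrow> assoc_proj (homeo_balanced F J `` {(e, y)}) = homeo_orbit F J e"
  by (rule group.assoc_proj_class[OF group_HomeoGroup]) (simp_all add: HomeoGroup_evaluation)

lemma continuous_map_homeo_orbit:
  "continuous_map (homeo_univ F J) (univ_base (HomeoGroup F) (arens_g_topology F) J) (\<lambda>e. homeo_orbit F J e)"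
  unfolding univ_base_def by (rule quotient_imp_continuous_map[OF quotient_map_quotient_space])

lemma continuous_map_homeo_balanced:
  "continuous_map (prod_topology (homeo_univ F J) F) (homeo_assoc F J) (\<lambda>x. homeo_balanced F J `` {x})"
  unfolding assoc_total_def by (rule quotient_imp_continuous_map[OF quotient_map_quotient_space])

text \<open>Every point of the class has the form \<open>(e g, g\<inverse> y)\<close>, and the \<open>i\<close>-th entry of \<open>e g\<close> sends
  \<open>g\<inverse> y\<close> to the same point as \<open>e i\<close> sends \<open>y\<close>. So the entries of \<open>e\<close> that are not the cone point
  give fiber coordinates on the associated bundle.\<close>

lemma homeo_balanced_coordinate:
  assumes r: "((e, y), (e', y')) \<in> homeo_balanced F J" and i: "i \<in> J" and g: "e i = Some g"
  shows "\<exists>g'. e' i = Some g' \<and> g' y' = g y"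
proof -
  obtain a where a: "a \<in> Homeo F" "e = right_act (HomeoGroup F) J e' a" "y' = a y"
      and e': "e' \<in> topspace (homeo_univ F J)" and y: "y \<in> topspace F"
    using r by (auto simp: balanced_rel_def)
  obtain g' where g': "e' i = Some g'" "g = g' \<otimes>\<^bsub>HomeoGroup F\<^esub> a"
    using a g i by (auto simp: right_act_def)
  moreover have "g' \<in> Homeo F"
    using e' i g'(1) by (fastforce simp: topspace_univ_total dest: PiE_mem)
  ultimately show ?thesis
    using a y by (simp add: HomeoGroup_evaluation)
qed

text \<open>The quantifier over representatives is harmless: by \<open>homeo_balanced_coordinate\<close>, either all or no
  representatives \<open>(e, y)\<close> of a class have \<open>e i\<close> in the group.\<close>

definition assoc_patch :: "'f topology \<Rightarrow> 'j set \<Rightarrow> 'j \<Rightarrow> (('j \<Rightarrow> ('f \<Rightarrow> 'f) option) \<times> 'f) set set" where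
  "assoc_patch F J i = {homeo_balanced F J `` {(e, y)} | e y.
     e \<in> topspace (homeo_univ F J) \<and> y \<in> topspace F \<and> e i \<noteq> None}"

definition assoc_coord :: "'i \<Rightarrow> (('i \<Rightarrow> ('f \<Rightarrow> 'f) option) \<times> 'f) set \<Rightarrow> 'f" where
  "assoc_coord i z = (THE w. \<exists>e y g. (e, y) \<in> z \<and> e i = Some g \<and> w = g y)"

lemma assoc_coord_class:
  assumes "e \<in> topspace (homeo_univ F J)" "y \<in> topspace F" "i \<in> J" "e i = Some g"
  shows "assoc_coord i (homeo_balanced F J `` {(e, y)}) = g y"
  unfolding assoc_coord_def
proof (rule the_equality)
  have "((e, y), (e, y)) \<in> homeo_balanced F J"
    using equiv_homeo_balanced[of F J] assms by (simp add: equiv_def refl_on_def)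
  then show "\<exists>e' y' g'. (e', y') \<in> homeo_balanced F J `` {(e, y)} \<and> e' i = Some g' \<and> g y = g' y'"
    using assms by blast
next
  fix w
  assume "\<exists>e' y' g'. (e', y') \<in> homeo_balanced F J `` {(e, y)} \<and> e' i = Some g' \<and> w = g' y'"
  then show "w = g y"
    using homeo_balanced_coordinate[of e y _ _ F J i g] assms(3,4) by fastforce
qed

text \<open>On representatives, the coordinate is the map \<open>(e, y) \<mapsto> e i y\<close>, which is the projection to the
  \<open>i\<close>-th entry followed by evaluation. The group is open in its cone, so the preimages of open sets
  under this partially defined map are open in the whole product, and they are saturated.\<close>

lemma continuous_map_assoc_coord:
  assumes F: "locally_compact_space F" "Hausdorff_space F" and i: "i \<in> J"
  shows "continuous_map
     (subtopology (homeo_assoc F J) (assoc_patch F J i)) F (assoc_coord i)"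
proof -
  let ?Q = "prod_topology (homeo_univ F J) F"
  let ?R = "homeo_balanced F J"
  let ?A = "assoc_patch F J i"
  have Homeo: "g \<in> Homeo F" if "e \<in> topspace (homeo_univ F J)" "e i = Some g" for e g
    using that i by (fastforce simp: topspace_univ_total dest: PiE_mem)
  have class_A: "?R `` {(e, y)} \<in> ?A \<longleftrightarrow> e i \<noteq> None"
    if "e \<in> topspace (homeo_univ F J)" "y \<in> topspace F" for e y
  proof
    assume "?R `` {(e, y)} \<in> ?A"
    then obtain e' y' where *: "e' \<in> topspace (homeo_univ F J)" "y' \<in> topspace F" "e' i \<noteq> None"
        "?R `` {(e', y')} = ?R `` {(e, y)}"
      unfolding assoc_patch_def by auto
    then have "((e', y'), (e, y)) \<in> ?R"
      using eq_equiv_class[OF *(4) equiv_homeo_balanced] that by simp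
    then show "e i \<noteq> None"
      using homeo_balanced_coordinate[of e' y' e y F J i] i * by fastforce
  next
    assume "e i \<noteq> None"
    with that show "?R `` {(e, y)} \<in> ?A"
      unfolding assoc_patch_def by blast
  qed
  have top_A: "?A \<subseteq> topspace ?Q // ?R"
    by (auto simp: assoc_patch_def intro!: quotientI)
  have top: "topspace (subtopology (homeo_assoc F J) ?A) = ?A"
    using top_A by (simp add: assoc_total_def inf.absorb2)
  show ?thesis
    unfolding continuous_map_def top
  proof (intro conjI allI impI)
    show "assoc_coord i \<in> ?A \<rightarrow> topspace F"
    proof
      fix z assume "z \<in> ?A"
      then obtain e y g where z: "z = ?R `` {(e, y)}" "e \<in> topspace (homeo_univ F J)"
          "y \<in> topspace F" "e i = Some g"
        by (auto simp: assoc_patch_def)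
      then show "assoc_coord i z \<in> topspace F"
        using assoc_coord_class[OF z(2,3) i z(4)] Homeo HomeoGroup_evaluation(1)[of y F g] by simp
    qed
    fix W assume W: "openin F W"
    let ?S = "{(g, y). g \<in> Homeo F \<and> y \<in> topspace F \<and> g y \<in> W}"
    let ?N = "{z \<in> ?A. assoc_coord i z \<in> W}"
    have entry: "continuous_map ?Q (prod_topology (indiscrete_cone (arens_g_topology F)) F) (\<lambda>(e, y). (e i, y))"
    proof -
      have "continuous_map (homeo_univ F J) (indiscrete_cone (arens_g_topology F)) (\<lambda>e. e i)"
        unfolding univ_total_def
        by (intro continuous_map_from_subtopology continuous_map_product_projection i)
      from continuous_map_compose[OF continuous_map_fst this] show ?thesis
        by (simp add: case_prod_unfold continuous_map_paired continuous_map_snd o_def)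
    qed
    have "openin ?Q {x \<in> topspace ?Q. (case x of (e, y) \<Rightarrow> (e i, y)) \<in> {(Some g, y) | g y. (g, y) \<in> ?S}}"
      using entry openin_prod_indiscrete_cone_Some[OF openin_evaluation_preimage[OF F W]]
      by (rule openin_continuous_map_preimage)
    moreover have "{x \<in> topspace ?Q. (case x of (e, y) \<Rightarrow> (e i, y)) \<in> {(Some g, y) | g y. (g, y) \<in> ?S}}
        = {x \<in> topspace ?Q. ?R `` {x} \<in> ?N}"
    proof (intro Collect_cong conj_cong refl)
      fix x assume "x \<in> topspace ?Q"
      then obtain e y where x: "x = (e, y)" "e \<in> topspace (homeo_univ F J)" "y \<in> topspace F"
        by auto
      have "?R `` {(e, y)} \<in> ?N \<longleftrightarrow> e i \<noteq> None \<and> assoc_coord i (?R `` {(e, y)}) \<in> W"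
        using class_A[OF x(2,3)] by (simp only: mem_Collect_eq)
      also have "\<dots> \<longleftrightarrow> (\<exists>g. e i = Some g \<and> g y \<in> W)"
        using assoc_coord_class[OF x(2,3) i] by (cases "e i") auto
      finally show "(case x of (e, y) \<Rightarrow> (e i, y)) \<in> {(Some g, y) | g y. (g, y) \<in> ?S} \<longleftrightarrow> ?R `` {x} \<in> ?N"
        using Homeo x by auto
    qed
    moreover have "?N \<subseteq> topspace ?Q // ?R"
      using top_A by (rule subset_trans[rotated]) (rule Collect_restrict)
    ultimately have "openin (homeo_assoc F J) ?N"
      unfolding assoc_total_def openin_quotient_space by argo
    then have "openin (subtopology (homeo_assoc F J) ?A) (?A \<inter> ?N)"
      by (rule openin_subtopology_Int2)
    moreover have "?A \<inter> ?N = ?N"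
      by (rule inf.absorb2) (rule Collect_restrict)
    ultimately show "openin (subtopology (homeo_assoc F J) ?A) ?N"
      by argo
  qed
qed

section \<open>The classifying map of a bundle with chosen charts\<close>

locale charted_bundle =
  fixes E :: "'e topology" and p :: "'e \<Rightarrow> 'b" and B :: "'b topology" and F :: "'f topology"
    and J :: "'j set" and U :: "'j \<Rightarrow> 'b set"
    and \<phi> :: "'j \<Rightarrow> 'e \<Rightarrow> 'b \<times> 'f" and \<psi> :: "'j \<Rightarrow> 'b \<times> 'f \<Rightarrow> 'e"
  assumes proj: "continuous_map E B p"
    and open_U: "\<And>j. j \<in> J \<Longrightarrow> openin B (U j)"
    and cover: "(\<Union>j\<in>J. U j) = topspace B"
    and chart: "\<And>j. j \<in> J \<Longrightarrow> homeomorphic_maps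
                 (subtopology E {x \<in> topspace E. p x \<in> U j}) (prod_topology (subtopology B (U j)) F) (\<phi> j) (\<psi> j)"
    and chart_over: "\<And>j x. \<lbrakk>j \<in> J; x \<in> topspace E; p x \<in> U j\<rbrakk> \<Longrightarrow> fst (\<phi> j x) = p x"
begin

abbreviation part :: "'j \<Rightarrow> 'e set" where
  "part j \<equiv> {x \<in> topspace E. p x \<in> U j}"

definition fibre :: "'j \<Rightarrow> 'e \<Rightarrow> 'f" where
  "fibre j x = snd (\<phi> j x)"

lemma U_subset: "j \<in> J \<Longrightarrow> b \<in> U j \<Longrightarrow> b \<in> topspace B"
  using cover by blast

lemma part_over_U: "x \<in> topspace E \<Longrightarrow> \<exists>j\<in>J. p x \<in> U j"
  using continuous_map_funspace[OF proj] cover by (auto simp: Pi_iff)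

lemma chart_eq: "\<lbrakk>j \<in> J; x \<in> part j\<rbrakk> \<Longrightarrow> \<phi> j x = (p x, fibre j x)"
  using chart_over by (auto simp: fibre_def prod_eq_iff)

lemma continuous_map_chart:
  "j \<in> J \<Longrightarrow> continuous_map (subtopology E (part j)) (prod_topology (subtopology B (U j)) F) (\<phi> j)"
  using chart by (simp add: homeomorphic_maps_def)

lemma continuous_map_inverse_chart:
  "j \<in> J \<Longrightarrow> continuous_map (prod_topology (subtopology B (U j)) F) E (\<psi> j)"
  using chart by (simp add: homeomorphic_maps_def continuous_map_in_subtopology)

lemma continuous_map_fibre:
  assumes "j \<in> J"
  shows "continuous_map (subtopology E (part j)) F (fibre j)"
  using continuous_map_compose[OF continuous_map_chart[OF assms] continuous_map_snd]
  by (simp add: o_def fibre_def[abs_def])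

lemma fibre_closed:
  assumes "j \<in> J" "x \<in> part j"
  shows "fibre j x \<in> topspace F"
  using Pi_mem[OF continuous_map_funspace[OF continuous_map_fibre[OF assms(1)]], of x] assms(2) by simp

lemma inverse_chart_fibre:
  assumes j: "j \<in> J" and x: "x \<in> part j"
  shows "\<psi> j (p x, fibre j x) = x"
proof -
  have "\<psi> j (\<phi> j x) = x"
    using chart[OF j] x by (simp add: homeomorphic_maps_def)
  then show ?thesis
    by (simp add: chart_eq[OF j x])
qed

lemma
  assumes j: "j \<in> J" and b: "b \<in> U j" and y: "y \<in> topspace F"
  shows inverse_chart_closed: "\<psi> j (b, y) \<in> topspace E"
    and proj_inverse_chart: "p (\<psi> j (b, y)) = b"
    and fibre_inverse_chart: "fibre j (\<psi> j (b, y)) = y"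
proof -
  have mem: "(b, y) \<in> topspace (prod_topology (subtopology B (U j)) F)"
    using assms U_subset by simp
  have "continuous_map (prod_topology (subtopology B (U j)) F) (subtopology E (part j)) (\<psi> j)"
    using chart[OF j] by (simp add: homeomorphic_maps_def)
  then have "\<psi> j (b, y) \<in> topspace (subtopology E (part j))"
    using mem by (rule Pi_mem[OF continuous_map_funspace])
  then have part: "\<psi> j (b, y) \<in> part j"
    by simp
  then show "\<psi> j (b, y) \<in> topspace E"
    by simp
  have "\<phi> j (\<psi> j (b, y)) = (b, y)"
    using chart[OF j] mem by (simp add: homeomorphic_maps_def)
  with chart_eq[OF j part] show "p (\<psi> j (b, y)) = b" "fibre j (\<psi> j (b, y)) = y"
    by simp_all
qed

definition transition :: "'j \<Rightarrow> 'j \<Rightarrow> 'b \<Rightarrow> 'f \<Rightarrow> 'f" where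
  "transition j i b = (\<lambda>y\<in>topspace F. fibre j (\<psi> i (b, y)))"

lemma transition_fibre:
  "\<lbrakk>i \<in> J; x \<in> part i\<rbrakk> \<Longrightarrow> transition j i (p x) (fibre i x) = fibre j x"
  by (simp add: transition_def fibre_closed inverse_chart_fibre)

lemma continuous_map_transition:
  assumes i: "i \<in> J" and j: "j \<in> J"
  shows "continuous_map (subtopology B (U i \<inter> U j)) (arens_g_topology F) (transition j i)"
proof -
  let ?X = "subtopology B (U i \<inter> U j)"
  have "continuous_map (prod_topology ?X F) F (\<lambda>(b, y). fibre l (\<psi> k (b, y)))"
    if k: "k \<in> J" and l: "l \<in> J" and kl: "U i \<inter> U j = U k \<inter> U l" for k l
  proof -
    \<comment> \<open>The transition from chart \<open>k\<close> to chart \<open>l\<close>; taking \<open>(k, l)\<close> as \<open>(i, j)\<close> and as \<open>(j, i)\<close> gives the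
      family and its inverse.\<close>
    have "continuous_map (prod_topology ?X F) (subtopology E (part l)) (\<psi> k)"
    proof (rule continuous_map_into_subtopology)
      have "continuous_map (subtopology (prod_topology (subtopology B (U k)) F) (U l \<times> topspace F)) E (\<psi> k)"
        by (rule continuous_map_from_subtopology[OF continuous_map_inverse_chart[OF k]])
      then show "continuous_map (prod_topology ?X F) E (\<psi> k)"
        by (simp add: kl flip: prod_topology_subtopology(1) subtopology_subtopology)
      show "\<psi> k \<in> topspace (prod_topology ?X F) \<rightarrow> part l"
        using inverse_chart_closed[OF k] proj_inverse_chart[OF k] by (auto simp: kl)
    qed
    from continuous_map_compose[OF this continuous_map_fibre[OF l]] show ?thesis
      by (simp add: case_prod_unfold o_def)
  qed
  note cont = this
  have inverse: "fibre k (\<psi> l (b, fibre l (\<psi> k (b, y)))) = y"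
    if "k \<in> J" "l \<in> J" "b \<in> U k" "b \<in> U l" "y \<in> topspace F" for k l b y
    using that inverse_chart_fibre[of l "\<psi> k (b, y)"]
    by (simp add: inverse_chart_closed proj_inverse_chart fibre_inverse_chart)
  show ?thesis
    unfolding transition_def[abs_def]
    by (rule continuous_map_into_arens_g_topology[where k = "\<lambda>b y. fibre i (\<psi> j (b, y))"])
      (use cont[OF i j] cont[OF j i Int_commute] inverse i j in auto)
qed

lemma transition_Homeo:
  assumes "i \<in> J" "j \<in> J" "b \<in> U i" "b \<in> U j"
  shows "transition j i b \<in> Homeo F"
  using Pi_mem[OF continuous_map_funspace[OF continuous_map_transition[OF assms(1,2)]], of b]
    U_subset[OF assms(1,3)] assms(3,4) by simp

lemma transition_self: "\<lbrakk>i \<in> J; b \<in> U i\<rbrakk> \<Longrightarrow> transition i i b = (\<lambda>y\<in>topspace F. y)"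
  unfolding transition_def by (rule restrict_ext) (rule fibre_inverse_chart)

lemma transition_cocycle:
  assumes "i \<in> J" "j \<in> J" "k \<in> J" "b \<in> U i" "b \<in> U j" "b \<in> U k"
  shows "transition j i b \<otimes>\<^bsub>HomeoGroup F\<^esub> transition i k b = transition j k b"
proof (rule extensionalityI)
  have "transition j i b \<otimes>\<^bsub>HomeoGroup F\<^esub> transition i k b \<in> Homeo F"
    using group.is_monoid[OF group_HomeoGroup[of F]] monoid.m_closed transition_Homeo assms
    by (metis carrier_HomeoGroup)
  then show "transition j i b \<otimes>\<^bsub>HomeoGroup F\<^esub> transition i k b \<in> extensional (topspace F)"
    by (simp add: Homeo_def)
  show "transition j k b \<in> extensional (topspace F)"
    by (simp add: transition_def)
  fix y assume y: "y \<in> topspace F"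
  let ?x = "\<psi> k (b, y)"
  have x: "?x \<in> topspace E" "p ?x = b" "fibre k ?x = y"
    using assms y by (simp_all add: inverse_chart_closed proj_inverse_chart fibre_inverse_chart)
  have "transition j i b (transition i k b y) = transition j k b y"
    using transition_fibre[of k ?x i] transition_fibre[of i ?x j] transition_fibre[of k ?x j] x assms by simp
  then show "(transition j i b \<otimes>\<^bsub>HomeoGroup F\<^esub> transition i k b) y = transition j k b y"
    using y assms transition_Homeo by (simp add: HomeoGroup_evaluation)
qed

text \<open>The point of the total space of the universal bundle that the \<open>i\<close>-th chart assigns to \<open>b\<close>. Its
  \<open>i\<close>-th entry is the identity of the group; in particular it is not the excluded point with all entries \<open>None\<close>.\<close>

definition frame :: "'j \<Rightarrow> 'b \<Rightarrow> 'j \<Rightarrow> ('f \<Rightarrow> 'f) option" where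
  "frame i b = (\<lambda>j\<in>J. if b \<in> U i \<inter> U j then Some (transition j i b) else None)"

lemma frame_eq: "\<lbrakk>j \<in> J; b \<in> U i\<rbrakk> \<Longrightarrow> frame i b j = (if b \<in> U j then Some (transition j i b) else None)"
  by (simp add: frame_def)

lemma continuous_map_frame:
  assumes i: "i \<in> J"
  shows "continuous_map (subtopology B (U i)) (homeo_univ F J) (frame i)"
  unfolding univ_total_def
proof (rule continuous_map_into_subtopology)
  show cont: "continuous_map (subtopology B (U i)) (product_topology (\<lambda>i. indiscrete_cone (arens_g_topology F)) J) (frame i)"
    unfolding continuous_map_componentwise
  proof (intro conjI ballI)
    show "frame i ` topspace (subtopology B (U i)) \<subseteq> extensional J"
      by (auto simp: frame_def)
    fix j assume j: "j \<in> J"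
    have "continuous_map (subtopology B (U i)) (indiscrete_cone (arens_g_topology F))
        (\<lambda>b. if b \<in> U i \<inter> U j then Some (transition j i b) else None)"
    proof (rule continuous_map_into_indiscrete_cone)
      show "openin (subtopology B (U i)) (U i \<inter> U j)"
        using open_U[OF j] by (simp add: openin_subtopology_Int2)
      show "continuous_map (subtopology (subtopology B (U i)) (U i \<inter> U j)) (arens_g_topology F) (transition j i)"
        using continuous_map_transition[OF i j] by (simp add: subtopology_subtopology flip: Int_assoc)
    qed
    then show "continuous_map (subtopology B (U i)) (indiscrete_cone (arens_g_topology F)) (\<lambda>b. frame i b j)"
      using j by (simp add: frame_def)
  qed
  have "frame i b \<noteq> (\<lambda>j\<in>J. None)" if "b \<in> U i" for b
  proof
    assume "frame i b = (\<lambda>j\<in>J. None)"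
    then have "frame i b i = None"
      using i by simp
    then show False
      using frame_eq[OF i that] that by simp
  qed
  then show "frame i \<in> topspace (subtopology B (U i)) \<rightarrow>
      topspace (product_topology (\<lambda>i. indiscrete_cone (arens_g_topology F)) J) - {\<lambda>j\<in>J. None}"
    using continuous_map_funspace[OF cont] by (auto simp: Pi_iff simp del: topspace_product_topology)
qed

lemma frame_closed:
  assumes "i \<in> J" "b \<in> U i"
  shows "frame i b \<in> topspace (homeo_univ F J)"
  using Pi_mem[OF continuous_map_funspace[OF continuous_map_frame[OF assms(1)]], of b]
    U_subset[OF assms] assms(2) by simp

lemma frame_change:
  assumes "i \<in> J" "k \<in> J" "b \<in> U i" "b \<in> U k"
  shows "right_act (HomeoGroup F) J (frame i b) (transition i k b) = frame k b"
  unfolding right_act_def frame_def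
proof (rule restrict_ext)
  fix j assume j: "j \<in> J"
  show "map_option (\<lambda>a. a \<otimes>\<^bsub>HomeoGroup F\<^esub> transition i k b)
      ((\<lambda>j\<in>J. if b \<in> U i \<inter> U j then Some (transition j i b) else None) j)
    = (if b \<in> U k \<inter> U j then Some (transition j k b) else None)"
    using j assms transition_cocycle[of i j k b] by simp
qed

lemma frame_orbit_eq:
  assumes "i \<in> J" "k \<in> J" "b \<in> U i" "b \<in> U k"
  shows "homeo_orbit F J (frame i b) = homeo_orbit F J (frame k b)"
proof (rule equiv_class_eq[OF equiv_homeo_orbit])
  show "(frame i b, frame k b) \<in> orbit_rel (HomeoGroup F) (arens_g_topology F) J"
    unfolding orbit_rel_def mem_Collect_eq
    using frame_change[OF assms] frame_closed transition_Homeo assms by (metis carrier_HomeoGroup)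
qed

text \<open>The transition function that carries one frame to the other also carries the fiber coordinates
  to each other, in the opposite direction, so the pairs are related.\<close>

lemma frame_class_eq:
  assumes "i \<in> J" "k \<in> J" and x: "x \<in> part i" "x \<in> part k"
  shows "homeo_balanced F J `` {(frame k (p x), fibre k x)} = homeo_balanced F J `` {(frame i (p x), fibre i x)}"
proof (rule equiv_class_eq[OF equiv_homeo_balanced])
  have px: "p x \<in> U i" "p x \<in> U k"
    using x by simp_all
  show "((frame k (p x), fibre k x), (frame i (p x), fibre i x)) \<in> homeo_balanced F J"
    unfolding balanced_rel_def mem_Collect_eq
    using assms px
    by (intro exI[of _ "frame i (p x)"] exI[of _ "transition i k (p x)"] exI[of _ "fibre k x"])
      (simp add: frame_change transition_fibre frame_closed transition_Homeo fibre_closed)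
qed

text \<open>Any chart around \<open>b\<close> gives the same classifying orbit, so an arbitrary choice will do.\<close>

definition index :: "'b \<Rightarrow> 'j" where
  "index b = (SOME j. j \<in> J \<and> b \<in> U j)"

lemma index:
  assumes "b \<in> topspace B"
  shows "index b \<in> J" "b \<in> U (index b)"
proof -
  have "\<exists>j. j \<in> J \<and> b \<in> U j"
    using assms cover by blast
  then show "index b \<in> J" "b \<in> U (index b)"
    unfolding index_def by (metis (mono_tags, lifting) someI_ex)+
qed

definition classify :: "'b \<Rightarrow> ('j \<Rightarrow> ('f \<Rightarrow> 'f) option) set" where
  "classify b = homeo_orbit F J (frame (index b) b)"

lemma classify_eq:
  assumes i: "i \<in> J" and b: "b \<in> U i"
  shows "classify b = homeo_orbit F J (frame i b)"
  unfolding classify_def by (rule frame_orbit_eq) (use i b index[OF U_subset[OF i b]] in simp_all)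

lemma continuous_map_classify:
  "continuous_map B (univ_base (HomeoGroup F) (arens_g_topology F) J) classify"
proof (rule pasting_lemma[where I = J and T = U and f = "\<lambda>i b. homeo_orbit F J (frame i b)"])
  fix i assume i: "i \<in> J"
  show "openin B (U i)"
    by (rule open_U[OF i])
  show "continuous_map (subtopology B (U i)) (univ_base (HomeoGroup F) (arens_g_topology F) J)
      (\<lambda>b. homeo_orbit F J (frame i b))"
    using continuous_map_compose[OF continuous_map_frame[OF i] continuous_map_homeo_orbit]
    unfolding o_def .
next
  fix i k b assume "i \<in> J" "k \<in> J" "b \<in> topspace B \<inter> U i \<inter> U k"
  then show "homeo_orbit F J (frame i b) = homeo_orbit F J (frame k b)"
    by (intro frame_orbit_eq) simp_all
next
  fix b assume "b \<in> topspace B"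
  from index[OF this] show "\<exists>j. j \<in> J \<and> b \<in> U j \<and> classify b = homeo_orbit F J (frame j b)"
    unfolding classify_def by blast
qed

abbreviation pulled_back :: "('b \<times> (('j \<Rightarrow> ('f \<Rightarrow> 'f) option) \<times> 'f) set) topology" where
  "pulled_back \<equiv> pullback_space B classify (homeo_assoc F J) assoc_proj"

definition compare_at :: "'j \<Rightarrow> 'e \<Rightarrow> 'b \<times> (('j \<Rightarrow> ('f \<Rightarrow> 'f) option) \<times> 'f) set" where
  "compare_at i x = (p x, homeo_balanced F J `` {(frame i (p x), fibre i x)})"

definition compare :: "'e \<Rightarrow> 'b \<times> (('j \<Rightarrow> ('f \<Rightarrow> 'f) option) \<times> 'f) set" where
  "compare x = compare_at (index (p x)) x"

lemma compare_at_eq: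
  assumes "i \<in> J" "k \<in> J" "x \<in> part i" "x \<in> part k"
  shows "compare_at i x = compare_at k x"
  using frame_class_eq[OF assms] by (simp add: compare_at_def)

lemma compare_eq:
  assumes i: "i \<in> J" and x: "x \<in> part i"
  shows "compare x = compare_at i x"
  unfolding compare_def
proof (rule compare_at_eq)
  have "p x \<in> topspace B"
    using U_subset[OF i] x by simp
  from index[OF this] show "index (p x) \<in> J" "x \<in> part (index (p x))"
    using x by simp_all
qed (fact i x)+

lemma continuous_map_compare_at:
  assumes i: "i \<in> J"
  shows "continuous_map (subtopology E (part i)) pulled_back (compare_at i)"
  unfolding pullback_space_def
proof (rule continuous_map_into_subtopology)
  let ?X = "subtopology E (part i)"
  have p: "continuous_map ?X B p"
    by (rule continuous_map_from_subtopology[OF proj])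
  then have "continuous_map ?X (subtopology B (U i)) p"
    by (rule continuous_map_into_subtopology) auto
  from continuous_map_compose[OF this continuous_map_frame[OF i]]
  have "continuous_map ?X (homeo_univ F J) (\<lambda>x. frame i (p x))"
    unfolding o_def .
  then have "continuous_map ?X (prod_topology (homeo_univ F J) F) (\<lambda>x. (frame i (p x), fibre i x))"
    using continuous_map_fibre[OF i] by (rule continuous_map_pairedI)
  from continuous_map_compose[OF this continuous_map_homeo_balanced]
  have cont: "continuous_map ?X (homeo_assoc F J) (\<lambda>x. homeo_balanced F J `` {(frame i (p x), fibre i x)})"
    unfolding o_def .
  then show "continuous_map ?X (prod_topology B (homeo_assoc F J)) (compare_at i)"
    unfolding compare_at_def[abs_def] using p by (intro continuous_map_pairedI)
  show "compare_at i \<in> topspace ?X \<rightarrow>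
      {(b, z). b \<in> topspace B \<and> z \<in> topspace (homeo_assoc F J) \<and> classify b = assoc_proj z}"
  proof
    fix x assume "x \<in> topspace ?X"
    then have x: "x \<in> part i"
      by simp
    then have "homeo_balanced F J `` {(frame i (p x), fibre i x)} \<in> topspace (homeo_assoc F J)"
      using Pi_mem[OF continuous_map_funspace[OF cont], of x] by simp
    then show "compare_at i x \<in>
        {(b, z). b \<in> topspace B \<and> z \<in> topspace (homeo_assoc F J) \<and> classify b = assoc_proj z}"
      using x i U_subset[OF i] classify_eq[OF i]
      by (simp add: compare_at_def assoc_proj_homeo frame_closed fibre_closed)
  qed
qed

lemma continuous_map_compare: "continuous_map E pulled_back compare"
proof (rule pasting_lemma[where I = J and T = part and f = compare_at])
  fix i assume i: "i \<in> J"
  show "openin E (part i)"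
    by (rule openin_continuous_map_preimage[OF proj open_U[OF i]])
  show "continuous_map (subtopology E (part i)) pulled_back (compare_at i)"
    by (rule continuous_map_compare_at[OF i])
next
  fix i k x assume "i \<in> J" "k \<in> J" "x \<in> topspace E \<inter> part i \<inter> part k"
  then show "compare_at i x = compare_at k x"
    by (intro compare_at_eq) simp_all
next
  fix x assume x: "x \<in> topspace E"
  then obtain j where "j \<in> J" "p x \<in> U j"
    using part_over_U by blast
  with x show "\<exists>j. j \<in> J \<and> x \<in> part j \<and> compare x = compare_at j x"
    using compare_eq[of j x] by auto
qed

definition compare_inverse_at :: "'j \<Rightarrow> 'b \<times> (('j \<Rightarrow> ('f \<Rightarrow> 'f) option) \<times> 'f) set \<Rightarrow> 'e" where
  "compare_inverse_at i w = \<psi> i (fst w, assoc_coord i (snd w))"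

lemma compare_inverse_at_compare:
  assumes i: "i \<in> J" and x: "x \<in> part i"
  shows "compare_inverse_at i (compare x) = x"
proof -
  have "frame i (p x) i = Some (\<lambda>y\<in>topspace F. y)"
    using i x by (simp add: frame_eq transition_self)
  then have "assoc_coord i (homeo_balanced F J `` {(frame i (p x), fibre i x)}) = fibre i x"
    using assoc_coord_class[of "frame i (p x)" F J "fibre i x" i] frame_closed fibre_closed[of i x] i x
    by simp
  then show ?thesis
    using compare_eq[OF i x] inverse_chart_fibre[OF i x] by (simp add: compare_inverse_at_def compare_at_def)
qed

text \<open>A point of the pullback over \<open>b\<close> is the class of some \<open>(e, y)\<close> with \<open>e\<close> in the orbit of the
  frame at \<open>b\<close>, so \<open>e\<close> can be moved to the frame itself.\<close>

lemma pulled_back_point: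
  assumes w: "(b, z) \<in> topspace pulled_back" and i: "i \<in> J" and b: "b \<in> U i"
  obtains y where "y \<in> topspace F" "z = homeo_balanced F J `` {(frame i b, y)}"
proof -
  have z: "z \<in> topspace (homeo_assoc F J)" "classify b = assoc_proj z"
    using w by (auto simp: pullback_space_def)
  then obtain e y where e: "e \<in> topspace (homeo_univ F J)" "y \<in> topspace F"
      "z = homeo_balanced F J `` {(e, y)}"
    by (auto simp: assoc_total_def elim!: quotientE)
  then have "homeo_orbit F J (frame i b) = homeo_orbit F J e"
    using z classify_eq[OF i b] by (simp add: assoc_proj_homeo)
  then have "(frame i b, e) \<in> orbit_rel (HomeoGroup F) (arens_g_topology F) J"
    using eq_equiv_class[OF _ equiv_homeo_orbit] e by blast
  then obtain g where g: "g \<in> Homeo F" "e = right_act (HomeoGroup F) J (frame i b) g"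
    by (auto simp: orbit_rel_def)
  then have "((e, y), (frame i b, g y)) \<in> homeo_balanced F J"
    using frame_closed[OF i b] e(2) by (auto simp: balanced_rel_def)
  then have "z = homeo_balanced F J `` {(frame i b, g y)}"
    using e(3) equiv_class_eq[OF equiv_homeo_balanced] by blast
  moreover have "g y \<in> topspace F"
    using g e(2) by (simp add: HomeoGroup_evaluation)
  ultimately show thesis
    using that by blast
qed

lemma compare_surj:
  assumes w: "(b, z) \<in> topspace pulled_back"
  obtains x where "x \<in> topspace E" "p x = b" "compare x = (b, z)"
proof -
  have b: "b \<in> topspace B"
    using w by (simp add: pullback_space_def)
  let ?i = "index b"
  obtain y where y: "y \<in> topspace F" "z = homeo_balanced F J `` {(frame ?i b, y)}"
    using pulled_back_point[OF w index[OF b]] .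
  let ?x = "\<psi> ?i (b, y)"
  have x: "?x \<in> topspace E" "p ?x = b" "fibre ?i ?x = y"
    using index[OF b] y(1) by (simp_all add: inverse_chart_closed proj_inverse_chart fibre_inverse_chart)
  moreover have "compare ?x = (b, z)"
    using x y(2) by (simp add: compare_def compare_at_def)
  ultimately show thesis
    using that by blast
qed

lemma continuous_map_compare_inverse_at:
  assumes F: "locally_compact_space F" "Hausdorff_space F" and i: "i \<in> J"
  shows "continuous_map (subtopology pulled_back {w \<in> topspace pulled_back. fst w \<in> U i}) E (compare_inverse_at i)"
proof -
  let ?Y = "subtopology pulled_back {w \<in> topspace pulled_back. fst w \<in> U i}"
  have fst: "continuous_map ?Y B fst" and snd: "continuous_map ?Y (homeo_assoc F J) snd"
    unfolding pullback_space_def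
    by (intro continuous_map_from_subtopology continuous_map_fst continuous_map_snd)+
  have fst_U: "continuous_map ?Y (subtopology B (U i)) fst"
    using fst by (rule continuous_map_into_subtopology) auto
  have "continuous_map ?Y (subtopology (homeo_assoc F J) (assoc_patch F J i)) snd"
    using snd
  proof (rule continuous_map_into_subtopology, intro funcsetI)
    fix w assume w: "w \<in> topspace ?Y"
    then have b: "fst w \<in> U i"
      by simp
    from w obtain y where "y \<in> topspace F" "snd w = homeo_balanced F J `` {(frame i (fst w), y)}"
      using pulled_back_point[of "fst w" "snd w" i] i by auto
    moreover have "frame i (fst w) i \<noteq> None"
      using i b by (simp add: frame_eq)
    ultimately show "snd w \<in> assoc_patch F J i"
      using frame_closed[OF i b] unfolding assoc_patch_def by blast
  qed
  from continuous_map_compose[OF this continuous_map_assoc_coord[OF F i]]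
  have "continuous_map ?Y F (\<lambda>w. assoc_coord i (snd w))"
    unfolding o_def .
  with fst_U have "continuous_map ?Y (prod_topology (subtopology B (U i)) F) (\<lambda>w. (fst w, assoc_coord i (snd w)))"
    by (rule continuous_map_pairedI)
  from continuous_map_compose[OF this continuous_map_inverse_chart[OF i]] show ?thesis
    by (simp add: o_def compare_inverse_at_def[abs_def])
qed

lemma homeomorphic_map_over_compare:
  assumes F: "locally_compact_space F" "Hausdorff_space F"
  shows "homeomorphic_map_over E p pulled_back fst compare"
proof -
  let ?inv = "\<lambda>w. compare_inverse_at (index (fst w)) w"
  let ?part = "\<lambda>i. {w \<in> topspace pulled_back. fst w \<in> U i}"
  have fst_pulled_back: "continuous_map pulled_back B fst"
    unfolding pullback_space_def by (intro continuous_map_from_subtopology continuous_map_fst)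
  have fst_B: "fst w \<in> topspace B" if "w \<in> topspace pulled_back" for w
    using Pi_mem[OF continuous_map_funspace[OF fst_pulled_back] that] .
  have "continuous_map pulled_back E ?inv"
  proof (rule pasting_lemma[where I = J and T = ?part and f = compare_inverse_at])
    fix i assume i: "i \<in> J"
    show "openin pulled_back (?part i)"
      by (rule openin_continuous_map_preimage[OF fst_pulled_back open_U[OF i]])
    show "continuous_map (subtopology pulled_back (?part i)) E (compare_inverse_at i)"
      by (rule continuous_map_compare_inverse_at[OF F i])
  next
    \<comment> \<open>Both candidates are the preimage of \<open>w\<close> under the comparison map, so they agree.\<close>
    fix i k w assume i: "i \<in> J" and k: "k \<in> J" and w: "w \<in> topspace pulled_back \<inter> ?part i \<inter> ?part k"
    then obtain x where "x \<in> topspace E" "p x = fst w" "compare x = w"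
      using compare_surj[of "fst w" "snd w"] by auto
    then show "compare_inverse_at i w = compare_inverse_at k w"
      using compare_inverse_at_compare[of i x] compare_inverse_at_compare[of k x] i k w by auto
  next
    fix w assume "w \<in> topspace pulled_back"
    then show "\<exists>j. j \<in> J \<and> w \<in> ?part j \<and> ?inv w = compare_inverse_at j w"
      using index[OF fst_B] by blast
  qed
  moreover have fst_compare: "fst (compare x) = p x" for x
    by (simp add: compare_def compare_at_def)
  have inv_compare: "?inv (compare x) = x" if "x \<in> topspace E" for x
    using compare_inverse_at_compare[of "index (p x)" x] index[of "p x"] that
      Pi_mem[OF continuous_map_funspace[OF proj] that] by (simp add: fst_compare)
  moreover have "compare (?inv w) = w" if "w \<in> topspace pulled_back" for w
    using compare_surj[of "fst w" "snd w"] that inv_compare by (metis prod.collapse)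
  ultimately have "homeomorphic_maps E pulled_back compare ?inv"
    using continuous_map_compare by (simp add: homeomorphic_maps_def)
  then show ?thesis
    using fst_compare by (simp add: homeomorphic_map_over_def homeomorphic_maps_imp_map)
qed

end

section \<open>Classification by indiscrete cones\<close>

text \<open>The cover is indexed by \<open>I\<close>, the power of the cone by \<open>J\<close>; as both sets have cardinality \<open>\<kappa>\<close>,
  the cover can be indexed by \<open>J\<close> too.\<close>

lemma trivializing_cover_reindex:
  assumes cover: "trivializing_cover E p B F I U" and s: "bij_betw s J I"
  shows "trivializing_cover E p B F J (\<lambda>j. U (s j))"
  using cover bij_betw_imp_surj_on[OF s] unfolding trivializing_cover_def by auto

theorem corollary2p13:
  fixes F :: "'f topology" and B :: "'b topology" and E :: "'e topology" and p :: "'e \<Rightarrow> 'b"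
    and \<kappa> :: "'k rel" and I :: "'i set" and U :: "'i \<Rightarrow> 'b set" and J :: "'j set"
  assumes "locally_compact_space F" and "Hausdorff_space F"
    and "locally_connected_space B"
    and "Card_order \<kappa>"
    and "fiber_bundle E p B F"
    and "trivializing_cover E p B F I U" and "ordIso2 (card_of I) \<kappa>"
    and "ordIso2 (card_of J) \<kappa>"
  shows "\<exists>f. continuous_map B (univ_base (HomeoGroup F) (arens_g_topology F) J) f \<and>
           (\<exists>\<Phi>. homeomorphic_map_over E p
                  (pullback_space B f
                     (assoc_total (HomeoGroup F) (arens_g_topology F) J (\<lambda>h y. h y) F) assoc_proj)
                  fst \<Phi>)"
proof -
  have "ordIso2 (card_of J) (card_of I)"
    using assms(7,8) ordIso_symmetric ordIso_transitive by blast
  then obtain s where s: "bij_betw s J I"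
    by (auto simp flip: card_of_ordIso)
  have cover: "trivializing_cover E p B F J (\<lambda>j. U (s j))"
    using assms(6) s by (rule trivializing_cover_reindex)
  have "\<exists>\<phi> \<psi>. homeomorphic_maps (subtopology E {x \<in> topspace E. p x \<in> U (s j)})
          (prod_topology (subtopology B (U (s j))) F) \<phi> \<psi> \<and>
        (\<forall>x \<in> topspace E. p x \<in> U (s j) \<longrightarrow> fst (\<phi> x) = p x)" if "j \<in> J" for j
    using cover that
    by (fastforce simp: trivializing_cover_def trivial_over_def homeomorphic_map_over_def homeomorphic_map_maps)
  then obtain \<phi> \<psi> where "\<And>j. j \<in> J \<Longrightarrow> homeomorphic_maps (subtopology E {x \<in> topspace E. p x \<in> U (s j)})
          (prod_topology (subtopology B (U (s j))) F) (\<phi> j) (\<psi> j)"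
      "\<And>j x. \<lbrakk>j \<in> J; x \<in> topspace E; p x \<in> U (s j)\<rbrakk> \<Longrightarrow> fst (\<phi> j x) = p x"
    by metis
  then interpret charted_bundle E p B F J "\<lambda>j. U (s j)" \<phi> \<psi>
    using assms(5) cover by unfold_locales (auto simp: fiber_bundle_def trivializing_cover_def)
  show ?thesis
    using continuous_map_classify homeomorphic_map_over_compare[OF assms(1,2)] by blast
qed

end
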